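(* Let $q$ be a prime power and let $m\ge 1$ be an integer. For each integer $n\ge 1$ let $U=\mathbb{F}_q^n$, $W=\mathbb{F}_q^m$, let $\mathcal{F}$ be the set of all functions $U\to W$, and let $\Gamma$ be the extended-affine group acting on $\mathcal{F}$. Let $F,G\in\mathcal{F}$ be independent and uniformly random. Then: 1. (EA-equivalence) $$\mathbb{P}(F\sim_{\mathrm{EA}}G)\;\le\;\frac{|\Gamma|}{|\mathcal{F}|}\;=\;q^{-mq^n+O((n+m)^2)}\;=\;q^{-\Omega(q^n)}.$$ 2. (CCZ-equivalence) $$\mathbb{P}(F\sim_{\mathrm{CCZ}}G)\;\le\;\frac{|\mathrm{AGL}(U\times W)|}{|\mathcal{F}|}\;=\;q^{-mq^n+O((n+m)^2)}\;=\;q^{-\Omega(q^n)}.$$ Here the two inequalities hold for every $n\ge 1$, and the asymptotic equalities are as $n\to\infty$ with $q$ and $m$ fixed.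
   Context: For a finite-dimensional $\mathbb{F}_q$-vector space $V$, $\mathrm{AGL}(V)$ is the group of affine permutations $x\mapsto Px+a$ of $V$ with $P$ an invertible linear map and $a\in V$; $\mathrm{Hom}(U,W)$ is the space of $\mathbb{F}_q$-linear maps $U\to W$. The extended-affine (EA) group $\Gamma$ has underlying set $\mathrm{AGL}(U)\times\mathrm{AGL}(W)\times\mathrm{Hom}(U,W)$. An element $g=(A_{\rm in},A_{\rm out},L)$, with $A_{\rm in}(x)=Px+a$ and $A_{\rm out}(y)=Qy+b$, acts on $F\in\mathcal{F}$ by $$(g\cdot F)(x)=A_{\rm out}\bigl(F(A_{\rm in}(x))\bigr)+L(x)=Q\,F(Px+a)+Lx+b ,$$ the group law on $\Gamma$ being the one given by composition of these transformations, so that this is a group action. $F\sim_{\mathrm{EA}}G$ means that $F$ and $G$ lie in the same $\Gamma$-orbit. The graph of $F$ is $\mathrm{Gr}(F)=\{(x,F(x)):x\in U\}\subseteq U\times W=\mathbb{F}_q^{n+m}$, and $F\sim_{\mathrm{CCZ}}G$ means that there is $\Phi\in\mathrm{AGL}(U\times W)$ with $\Phi(\mathrm{Gr}(F))=\mathrm{Gr}(G)$. One has $|\Gamma|=|\mathrm{AGL}(U)|\cdot|\mathrm{AGL}(W)|\cdot q^{nm}$ and $|\mathcal{F}|=q^{mq^n}$. Asymptotic notation: $O((n+m)^2)$ stands for a quantity of absolute value at most $C(n+m)^2$ for some constant $C>0$ and all large $n$; $\Omega(q^n)$ stands for a quantity at least $C'q^n$ for some constant $C'>0$ and all large $n$.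 *)

theory Defs
  imports
    "HOL-Probability.Probability"
    "HOL-Library.Landau_Symbols"
    "HOL-Algebra.Group_Action"
    "Jordan_Normal_Form.VS_Connect"
begin

text \<open>
  The field with \<open>q\<close> elements is a type \<open>'k\<close> of sort \<open>{field, finite}\<close> with \<open>CARD('k) = q\<close>;
  \<open>U\<close> and \<open>W\<close> are \<open>carrier_vec n\<close> and \<open>carrier_vec m\<close> over \<open>'k\<close>. Maps between such carriers are
  taken extensional (\<open>undefined\<close> outside the carrier), so that equality and cardinality of sets of
  maps have their usual meaning.
\<close>

definition fun_space :: "'k itself \<Rightarrow> nat \<Rightarrow> nat \<Rightarrow> ('k vec \<Rightarrow> 'k vec) set" where
  "fun_space _ n m = carrier_vec n \<rightarrow>\<^sub>E carrier_vec m"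

definition Hom :: "'k::field itself \<Rightarrow> nat \<Rightarrow> nat \<Rightarrow> ('k vec \<Rightarrow> 'k vec) set" where
  "Hom _ n m =
     LinearCombinations.module_hom class_ring (module_vec TYPE('k) n) (module_vec TYPE('k) m)
       \<inter> extensional (carrier_vec n)"

definition AGL :: "'k::field itself \<Rightarrow> nat \<Rightarrow> ('k vec \<Rightarrow> 'k vec) set" where
  "AGL _ n = {\<lambda>x\<in>carrier_vec n. P x + a | P a.
     P \<in> Hom TYPE('k) n n \<and> bij_betw P (carrier_vec n) (carrier_vec n) \<and> a \<in> carrier_vec n}"

type_synonym 'k ea = "('k vec \<Rightarrow> 'k vec) \<times> ('k vec \<Rightarrow> 'k vec) \<times> ('k vec \<Rightarrow> 'k vec)"

definition EA_act :: "nat \<Rightarrow> nat \<Rightarrow> 'k::field ea \<Rightarrow> ('k vec \<Rightarrow> 'k vec) \<Rightarrow> 'k vec \<Rightarrow> 'k vec" where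
  "EA_act n m = (\<lambda>(A, B, L).
     \<lambda>F\<in>fun_space TYPE('k) n m. \<lambda>x\<in>carrier_vec n. B (F (A x)) + L x)"

text \<open>
  With \<open>B y = Q y + b\<close>, applying \<open>(A', B', L')\<close> and then \<open>(A, B, L)\<close> turns \<open>F\<close> into
  \<open>x \<mapsto> B (B' (F (A' (A x))) + L' (A x)) + L x\<close>. Since \<open>A\<close> need not fix \<open>0\<close>, the term
  \<open>L' (A x)\<close> contributes the constant \<open>L' (A 0)\<close>, which goes into the outer affine map, and the
  linear remainder \<open>Q (L' (A x - A 0)) = B (L' (A x)) - B (L' (A 0))\<close>.
\<close>

definition EA_mult :: "nat \<Rightarrow> nat \<Rightarrow> 'k::field ea \<Rightarrow> 'k ea \<Rightarrow> 'k ea" where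
  "EA_mult n m = (\<lambda>(A, B, L) (A', B', L').
     (\<lambda>x\<in>carrier_vec n. A' (A x),
      \<lambda>y\<in>carrier_vec m. B (B' y + L' (A (0\<^sub>v n))),
      \<lambda>x\<in>carrier_vec n. (B (L' (A x)) - B (L' (A (0\<^sub>v n)))) + L x))"

definition EA_group :: "'k::field itself \<Rightarrow> nat \<Rightarrow> nat \<Rightarrow> 'k ea monoid" where
  "EA_group _ n m =
     \<lparr>carrier = AGL TYPE('k) n \<times> AGL TYPE('k) m \<times> Hom TYPE('k) n m,
      monoid.mult = EA_mult n m,
      one = (\<lambda>x\<in>carrier_vec n. x, \<lambda>y\<in>carrier_vec m. y, \<lambda>x\<in>carrier_vec n. 0\<^sub>v m)\<rparr>"

definition EA_equiv :: "nat \<Rightarrow> nat \<Rightarrow> ('k::field vec \<Rightarrow> 'k vec) \<Rightarrow> ('k vec \<Rightarrow> 'k vec) \<Rightarrow> bool" where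
  "EA_equiv n m F G \<longleftrightarrow> G \<in> orbit (EA_group TYPE('k) n m) (EA_act n m) F"

text \<open>\<open>U \<times> W\<close> is identified with \<open>carrier_vec (n + m)\<close> by concatenation of vectors.\<close>

definition Gr :: "nat \<Rightarrow> ('k vec \<Rightarrow> 'k vec) \<Rightarrow> 'k vec set" where
  "Gr n F = {x @\<^sub>v F x | x. x \<in> carrier_vec n}"

definition CCZ_equiv :: "nat \<Rightarrow> nat \<Rightarrow> ('k::field vec \<Rightarrow> 'k vec) \<Rightarrow> ('k vec \<Rightarrow> 'k vec) \<Rightarrow> bool" where
  "CCZ_equiv n m F G \<longleftrightarrow> (\<exists>\<Phi>\<in>AGL TYPE('k) (n + m). \<Phi> ` Gr n F = Gr n G)"

definition random_pair ::
    "'k::{field,finite} itself \<Rightarrow> nat \<Rightarrow> nat \<Rightarrow> (('k vec \<Rightarrow> 'k vec) \<times> ('k vec \<Rightarrow> 'k vec)) pmf" where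
  "random_pair _ n m =
     pair_pmf (pmf_of_set (fun_space TYPE('k) n m)) (pmf_of_set (fun_space TYPE('k) n m))"

text \<open>
  One-sided lower bound: unlike \<open>\<Omega>(g)\<close> from the Landau symbols, which only bounds \<open>\<bar>h n\<bar>\<close>
  from below, this forces \<open>h n\<close> itself to be large.
\<close>

definition at_least_order :: "(nat \<Rightarrow> real) \<Rightarrow> (nat \<Rightarrow> real) set" where
  "at_least_order g = {h. \<exists>C>0. \<forall>\<^sub>F n in sequentially. C * g n \<le> h n}"


text \<open>The set \<open>fun_space\<close> is finite and nonempty, so \<open>pmf_of_set\<close> is the uniform distribution on it.\<close>

lemma finite_carrier_vec: "finite (carrier_vec n :: 'k::finite vec set)"
proof -
  have "carrier_vec n \<subseteq> vec_of_list ` {xs :: 'k list. set xs \<subseteq> UNIV \<and> length xs = n}"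
  proof
    fix v :: "'k vec" assume "v \<in> carrier_vec n"
    then have "length (list_of_vec v) = n" by auto
    then show "v \<in> vec_of_list ` {xs. set xs \<subseteq> UNIV \<and> length xs = n}"
      by (intro image_eqI[of _ _ "list_of_vec v"]) (auto simp: vec_list)
  qed
  moreover have "finite {xs :: 'k list. set xs \<subseteq> UNIV \<and> length xs = n}"
    by (rule finite_lists_length_eq) simp
  ultimately show ?thesis using finite_surj by blast
qed

lemma finite_fun_space: "finite (fun_space TYPE('k::finite) n m)"
  unfolding fun_space_def by (intro finite_PiE finite_carrier_vec)

lemma fun_space_nonempty: "fun_space TYPE('k::field) n m \<noteq> {}"
proof -
  have "(\<lambda>x\<in>carrier_vec n. 0\<^sub>v m) \<in> fun_space TYPE('k) n m" by (auto simp: fun_space_def)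
  then show ?thesis by blast
qed


text \<open>The group law above makes the EA group a group acting on \<open>fun_space\<close>.\<close>

lemma Hom_iff:
  "L \<in> Hom TYPE('k::field) n m \<longleftrightarrow>
     L \<in> carrier_vec n \<rightarrow>\<^sub>E carrier_vec m \<and>
     (\<forall>x\<in>carrier_vec n. \<forall>y\<in>carrier_vec n. L (x + y) = L x + L y) \<and>
     (\<forall>c. \<forall>x\<in>carrier_vec n. L (c \<cdot>\<^sub>v x) = c \<cdot>\<^sub>v L x)"
  unfolding Hom_def LinearCombinations.module_hom_def PiE_def
  by (auto simp: module_vec_simps class_ring_simps)

lemma HomD:
  assumes "L \<in> Hom TYPE('k::field) n m"
  shows Hom_closed: "x \<in> carrier_vec n \<Longrightarrow> L x \<in> carrier_vec m"
    and Hom_ext: "L \<in> extensional (carrier_vec n)"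
    and Hom_add: "x \<in> carrier_vec n \<Longrightarrow> y \<in> carrier_vec n \<Longrightarrow> L (x + y) = L x + L y"
    and Hom_smult: "x \<in> carrier_vec n \<Longrightarrow> L (c \<cdot>\<^sub>v x) = c \<cdot>\<^sub>v L x"
  using assms unfolding Hom_iff by (auto simp: PiE_def)

lemma Hom_zero:
  assumes "L \<in> Hom TYPE('k::field) n m" shows "L (0\<^sub>v n) = 0\<^sub>v m"
proof -
  have "L (0\<^sub>v n) = L (0 \<cdot>\<^sub>v 0\<^sub>v n)" by (rule arg_cong[of _ _ L]) (auto intro!: eq_vecI)
  also have "\<dots> = 0 \<cdot>\<^sub>v L (0\<^sub>v n)" by (rule Hom_smult[OF assms]) simp
  also have "\<dots> = 0\<^sub>v m" using Hom_closed[OF assms, of "0\<^sub>v n"] by (intro eq_vecI) (auto simp: algebra_simps)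
  finally show ?thesis .
qed

lemma Hom_minus:
  assumes "L \<in> Hom TYPE('k::field) n m" "x \<in> carrier_vec n" "y \<in> carrier_vec n"
  shows "L (x - y) = L x - L y"
proof -
  have "L (x + (-1) \<cdot>\<^sub>v y) = L x + (-1) \<cdot>\<^sub>v L y"
    using assms by (simp add: HomD[OF assms(1)])
  moreover have "x + (-1) \<cdot>\<^sub>v y = x - y" using assms(2,3) by (intro eq_vecI) (auto simp: algebra_simps)
  moreover have "L x + (-1) \<cdot>\<^sub>v L y = L x - L y"
    using Hom_closed[OF assms(1) assms(2)] Hom_closed[OF assms(1) assms(3)]
    by (intro eq_vecI) (auto simp: algebra_simps)
  ultimately show ?thesis by simp
qed

lemma AGL_E:
  assumes "A \<in> AGL TYPE('k::field) n"
  obtains P a where "P \<in> Hom TYPE('k) n n" "bij_betw P (carrier_vec n) (carrier_vec n)"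
    "a \<in> carrier_vec n" "A = (\<lambda>x\<in>carrier_vec n. P x + a)"
  using assms unfolding AGL_def by blast

lemma bij_translation:
  assumes "c \<in> carrier_vec n"
  shows "bij_betw (\<lambda>x. x + c) (carrier_vec n) (carrier_vec n :: 'k::field vec set)"
  by (rule bij_betw_byWitness[where f' = "\<lambda>x. x - c"]) (use assms in auto)

lemma AGL_I:
  assumes "A \<in> Bij (carrier_vec n)" "P \<in> Hom TYPE('k::field) n n" "a \<in> carrier_vec n"
    and eq: "\<And>x. x \<in> carrier_vec n \<Longrightarrow> A x = P x + a"
  shows "A \<in> AGL TYPE('k) n"
proof -
  have A: "bij_betw A (carrier_vec n) (carrier_vec n)" "A \<in> extensional (carrier_vec n)"
    using assms(1) by (auto simp: Bij_def)
  have "bij_betw ((\<lambda>x. x + (- a)) \<circ> A) (carrier_vec n) (carrier_vec n)"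
    using A(1) bij_translation[of "- a" n] assms(3) by (intro bij_betw_trans) auto
  moreover have "((\<lambda>x. x + (- a)) \<circ> A) x = P x" if "x \<in> carrier_vec n" for x
    using eq[OF that] Hom_closed[OF assms(2) that] assms(3) by auto
  ultimately have "bij_betw P (carrier_vec n) (carrier_vec n)"
    by (metis (no_types, lifting) bij_betw_cong)
  moreover have "A = (\<lambda>x\<in>carrier_vec n. P x + a)"
    using A(2) eq by (auto simp: extensional_def fun_eq_iff)
  ultimately show ?thesis unfolding AGL_def using assms by blast
qed

lemma AGL_Bij:
  assumes "A \<in> AGL TYPE('k::field) n" shows "A \<in> Bij (carrier_vec n)"
proof -
  obtain P a where P: "P \<in> Hom TYPE('k) n n" "bij_betw P (carrier_vec n) (carrier_vec n)"
    "a \<in> carrier_vec n" "A = (\<lambda>x\<in>carrier_vec n. P x + a)" using assms by (rule AGL_E)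
  have "bij_betw ((\<lambda>x. x + a) \<circ> P) (carrier_vec n) (carrier_vec n)"
    using P(2) bij_translation[OF P(3)] by (rule bij_betw_trans)
  then have "bij_betw A (carrier_vec n) (carrier_vec n)"
    by (rule bij_betw_cong[THEN iffD1, rotated]) (simp add: P(4))
  then show ?thesis by (simp add: Bij_def P(4))
qed

lemma AGL_closed: "A \<in> AGL TYPE('k::field) n \<Longrightarrow> x \<in> carrier_vec n \<Longrightarrow> A x \<in> carrier_vec n"
  using AGL_Bij Bij_imp_funcset by blast

lemma AGL_affine:
  assumes "A \<in> AGL TYPE('k::field) n"
    and "x \<in> carrier_vec n" "y \<in> carrier_vec n" "z \<in> carrier_vec n"
  shows "A (x + y - z) = A x + A y - A z"
proof -
  obtain P a where P: "P \<in> Hom TYPE('k) n n" "bij_betw P (carrier_vec n) (carrier_vec n)"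
    "a \<in> carrier_vec n" "A = (\<lambda>x\<in>carrier_vec n. P x + a)" using assms(1) by (rule AGL_E)
  note c = Hom_closed[OF P(1) assms(2)] Hom_closed[OF P(1) assms(3)] Hom_closed[OF P(1) assms(4)]
  have "A (x + y - z) = P x + P y - P z + a"
    using assms P by (simp add: Hom_minus[OF P(1)] Hom_add[OF P(1)])
  also have "\<dots> = (P x + a) + (P y + a) - (P z + a)"
    using c P(3) by (intro eq_vecI) (auto simp: algebra_simps)
  also have "\<dots> = A x + A y - A z" using assms P by simp
  finally show ?thesis .
qed

lemma one_AGL: "(\<lambda>x\<in>carrier_vec n. x) \<in> AGL TYPE('k::field) n"
  by (rule AGL_I[where P = "\<lambda>x\<in>carrier_vec n. x" and a = "0\<^sub>v n"]) (auto simp: id_Bij Hom_iff)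

lemma translation_AGL:
  assumes "c \<in> carrier_vec n"
  shows "(\<lambda>x\<in>carrier_vec n. x + c) \<in> AGL TYPE('k::field) n"
proof (rule AGL_I[where P = "\<lambda>x\<in>carrier_vec n. x" and a = c])
  have "bij_betw (\<lambda>x\<in>carrier_vec n. x + c) (carrier_vec n) (carrier_vec n)"
    using bij_translation[OF assms] by (rule bij_betw_cong[THEN iffD1, rotated]) simp
  then show "(\<lambda>x\<in>carrier_vec n. x + c) \<in> Bij (carrier_vec n)" by (simp add: Bij_def)
qed (use assms in \<open>auto simp: Hom_iff\<close>)

lemma compose_AGL:
  assumes "A \<in> AGL TYPE('k::field) n" "B \<in> AGL TYPE('k) n"
  shows "(\<lambda>x\<in>carrier_vec n. A (B x)) \<in> AGL TYPE('k) n"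
proof -
  obtain P a where P: "P \<in> Hom TYPE('k) n n" "a \<in> carrier_vec n"
    "A = (\<lambda>x\<in>carrier_vec n. P x + a)" using assms(1) by (rule AGL_E)
  obtain Q b where Q: "Q \<in> Hom TYPE('k) n n" "b \<in> carrier_vec n"
    "B = (\<lambda>x\<in>carrier_vec n. Q x + b)" using assms(2) by (rule AGL_E)
  note c = Hom_closed[OF P(1)] Hom_closed[OF Q(1)]
  show ?thesis
  proof (rule AGL_I[where P = "\<lambda>x\<in>carrier_vec n. P (Q x)" and a = "P b + a"])
    show "(\<lambda>x\<in>carrier_vec n. A (B x)) \<in> Bij (carrier_vec n)"
      using compose_Bij[OF AGL_Bij AGL_Bij, OF assms] by (simp add: compose_def)
    show "(\<lambda>x\<in>carrier_vec n. P (Q x)) \<in> Hom TYPE('k) n n"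
      using HomD[OF P(1)] HomD[OF Q(1)] by (auto simp: Hom_iff)
    show "P b + a \<in> carrier_vec n" using c P(2) Q(2) by auto
    fix x :: "'k vec" assume x: "x \<in> carrier_vec n"
    have "(\<lambda>x\<in>carrier_vec n. A (B x)) x = P (Q x) + P b + a"
      using x c P(2,3) Q(2,3) by (simp add: Hom_add[OF P(1)])
    also have "\<dots> = P (Q x) + (P b + a)"
      using x c P(2) Q(2) by (intro assoc_add_vec[of _ n]) auto
    finally show "(\<lambda>x\<in>carrier_vec n. A (B x)) x = (\<lambda>x\<in>carrier_vec n. P (Q x)) x + (P b + a)"
      using x by simp
  qed
qed

lemma inv_AGL:
  assumes "A \<in> AGL TYPE('k::field) n"
  obtains A' where "A' \<in> AGL TYPE('k) n"
    "\<And>x. x \<in> carrier_vec n \<Longrightarrow> A' (A x) = x" "\<And>x. x \<in> carrier_vec n \<Longrightarrow> A (A' x) = x"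
proof -
  let ?V = "carrier_vec n :: 'k vec set"
  obtain P a where P: "P \<in> Hom TYPE('k) n n" "bij_betw P ?V ?V"
    "a \<in> carrier_vec n" "A = (\<lambda>x\<in>carrier_vec n. P x + a)" using assms by (rule AGL_E)
  define R where "R = (\<lambda>x\<in>?V. inv_into ?V P x)"
  have Rc: "R x \<in> ?V" and PR: "P (R x) = x" if "x \<in> ?V" for x
    using that P(2) by (auto simp: R_def bij_betw_def f_inv_into_f inv_into_into)
  have inj: "x = y" if "P x = P y" "x \<in> ?V" "y \<in> ?V" for x y
    using that P(2) by (auto simp: bij_betw_def inj_on_def)
  have R: "R \<in> Hom TYPE('k) n n"
    unfolding Hom_iff
  proof (intro conjI ballI allI)
    show "R \<in> ?V \<rightarrow>\<^sub>E ?V" using Rc by (auto simp: R_def)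
    fix x y :: "'k vec" assume x: "x \<in> ?V" and y: "y \<in> ?V"
    show "R (x + y) = R x + R y"
      by (rule inj) (use x y in \<open>auto simp: Rc PR Hom_add[OF P(1)]\<close>)
  next
    fix x :: "'k vec" and k assume x: "x \<in> ?V"
    show "R (k \<cdot>\<^sub>v x) = k \<cdot>\<^sub>v R x"
      by (rule inj) (use x in \<open>auto simp: Rc PR Hom_smult[OF P(1)]\<close>)
  qed
  define A' where "A' = (\<lambda>x\<in>?V. inv_into ?V A x)"
  have bA: "bij_betw A ?V ?V" using AGL_Bij[OF assms] by (simp add: Bij_def)
  have A'A: "A' (A x) = x" and AA': "A (A' x) = x" and A'c: "A' x \<in> ?V" if "x \<in> ?V" for x
    using that bA AGL_closed[OF assms that]
    by (auto simp: A'_def bij_betw_def inv_into_f_f f_inv_into_f inv_into_into)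
  have "A' \<in> AGL TYPE('k) n"
  proof (rule AGL_I[where P = R and a = "- R a"])
    show "A' \<in> Bij ?V" unfolding A'_def by (rule restrict_inv_into_Bij[OF AGL_Bij[OF assms]])
    show "R \<in> Hom TYPE('k) n n" by (rule R)
    show "- R a \<in> ?V" using Rc[OF P(3)] by simp
    fix x :: "'k vec" assume x: "x \<in> ?V"
    have "x = P (A' x) + a" using AA'[OF x] A'c[OF x] P(4) by simp
    then have "x - a = P (A' x) + a - a" by (rule arg_cong[of _ _ "\<lambda>z. z - a"])
    also have "\<dots> = P (A' x)"
      using P(3) Hom_closed[OF P(1) A'c[OF x]] by (intro eq_vecI) auto
    finally have h: "P (A' x) = x - a" by (rule sym)
    have "A' x = R (x - a)"
      by (rule inj) (use x P(3) A'c Rc in \<open>simp_all add: PR h\<close>)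
    also have "\<dots> = R x - R a" by (rule Hom_minus[OF R x P(3)])
    also have "\<dots> = R x + - R a" by (rule minus_add_uminus_vec[OF Rc[OF x] Rc[OF P(3)]])
    finally show "A' x = R x + - R a" .
  qed
  with A'A AA' that show thesis by blast
qed

lemma conj_Hom:
  assumes A: "A \<in> AGL TYPE('k::field) n" and B: "B \<in> AGL TYPE('k) m" and L: "L \<in> Hom TYPE('k) n m"
  shows "(\<lambda>x\<in>carrier_vec n. B (L (A x)) - B (L (A (0\<^sub>v n)))) \<in> Hom TYPE('k) n m"
proof -
  obtain P a where P: "P \<in> Hom TYPE('k) n n" "a \<in> carrier_vec n"
    "A = (\<lambda>x\<in>carrier_vec n. P x + a)" using A by (rule AGL_E)
  obtain Q b where Q: "Q \<in> Hom TYPE('k) m m" "b \<in> carrier_vec m"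
    "B = (\<lambda>x\<in>carrier_vec m. Q x + b)" using B by (rule AGL_E)
  note c = Hom_closed[OF P(1)] Hom_closed[OF Q(1)] Hom_closed[OF L]
  have e: "B (L (A x)) - B (L (A (0\<^sub>v n))) = Q (L (P x))" if x: "x \<in> carrier_vec n" for x
  proof -
    have "B (L (A x)) = Q (L (P x)) + Q (L a) + b"
      using x P Q c by (simp add: Hom_add[OF L] Hom_add[OF Q(1)])
    moreover have "B (L (A (0\<^sub>v n))) = Q (L a) + b"
      using P Q c by (simp add: Hom_zero[OF P(1)])
    moreover have "Q (L (P x)) + Q (L a) + b - (Q (L a) + b) = Q (L (P x))"
      using c(2)[OF c(3)[OF c(1)[OF x]]] c(2)[OF c(3)[OF P(2)]] Q(2) by (intro eq_vecI) (auto simp: algebra_simps)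
    ultimately show ?thesis by simp
  qed
  have "(\<lambda>x\<in>carrier_vec n. B (L (A x)) - B (L (A (0\<^sub>v n)))) = (\<lambda>x\<in>carrier_vec n. Q (L (P x)))"
    using e by (auto simp: fun_eq_iff)
  also have "\<dots> \<in> Hom TYPE('k) n m"
    using HomD[OF P(1)] HomD[OF Q(1)] HomD[OF L] by (auto simp: Hom_iff)
  finally show ?thesis .
qed

lemma add_Hom:
  assumes L: "L \<in> Hom TYPE('k::field) n m" and M: "M \<in> Hom TYPE('k) n m"
  shows "(\<lambda>x\<in>carrier_vec n. L x + M x) \<in> Hom TYPE('k) n m"
proof -
  note c = Hom_closed[OF L] Hom_closed[OF M]
  have "L x + L y + (M x + M y) = L x + M x + (L y + M y)"
    if "x \<in> carrier_vec n" "y \<in> carrier_vec n" for x y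
    using c(1)[OF that(1)] c(1)[OF that(2)] c(2)[OF that(1)] c(2)[OF that(2)]
    by (intro eq_vecI) (auto simp: algebra_simps)
  moreover have "k \<cdot>\<^sub>v L x + k \<cdot>\<^sub>v M x = k \<cdot>\<^sub>v (L x + M x)" if "x \<in> carrier_vec n" for k x
    using c(1)[OF that] c(2)[OF that] by (simp add: smult_add_distrib_vec)
  ultimately show ?thesis using HomD[OF L] HomD[OF M] by (auto simp: Hom_iff)
qed

lemma uminus_Hom:
  assumes L: "L \<in> Hom TYPE('k::field) n m"
  shows "(\<lambda>x\<in>carrier_vec n. - L x) \<in> Hom TYPE('k) n m"
proof -
  note c = Hom_closed[OF L]
  have "- (L x + L y) = - L x + - L y" if "x \<in> carrier_vec n" "y \<in> carrier_vec n" for x y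
    using c[OF that(1)] c[OF that(2)] by (intro eq_vecI) (auto simp: algebra_simps)
  moreover have "- (k \<cdot>\<^sub>v L x) = k \<cdot>\<^sub>v (- L x)" if "x \<in> carrier_vec n" for k x
    using c[OF that] by (intro eq_vecI) (auto simp: algebra_simps)
  ultimately show ?thesis using HomD[OF L] by (auto simp: Hom_iff)
qed

lemma group_EA_group: "group (EA_group TYPE('k::field) n m)"
proof (rule groupI)
  let ?G = "EA_group TYPE('k) n m"
  show "\<one>\<^bsub>?G\<^esub> \<in> carrier ?G"
    by (auto simp: EA_group_def one_AGL Hom_iff)
  fix g assume "g \<in> carrier ?G"
  then obtain A B L where g: "g = (A, B, L)" and
    A: "A \<in> AGL TYPE('k) n" and B: "B \<in> AGL TYPE('k) m" and L: "L \<in> Hom TYPE('k) n m"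
    by (auto simp: EA_group_def)
  note cg = AGL_closed[OF A] AGL_closed[OF B] Hom_closed[OF L]
  have extg: "A \<in> extensional (carrier_vec n)" "B \<in> extensional (carrier_vec m)"
      "L \<in> extensional (carrier_vec n)"
    using AGL_Bij[OF A] AGL_Bij[OF B] Hom_ext[OF L] by (auto simp: Bij_def)
  show "\<one>\<^bsub>?G\<^esub> \<otimes>\<^bsub>?G\<^esub> g = g"
  proof -
    let ?i = "\<lambda>x\<in>carrier_vec n. x" and ?j = "\<lambda>y\<in>carrier_vec m. y"
    have "(\<lambda>x\<in>carrier_vec n. A (?i x)) = A"
      by (rule ext) (simp add: extensional_arb[OF extg(1)])
    moreover have "?j (B y + L (?i (0\<^sub>v n))) = B y" if "y \<in> carrier_vec m" for y
      using cg(2)[OF that] by (simp add: Hom_zero[OF L])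
    then have "(\<lambda>y\<in>carrier_vec m. ?j (B y + L (?i (0\<^sub>v n)))) = B"
      by (intro ext) (simp add: extensional_arb[OF extg(2)])
    moreover have "(?j (L (?i x)) - ?j (L (?i (0\<^sub>v n)))) + (\<lambda>x\<in>carrier_vec n. 0\<^sub>v m) x = L x"
      if "x \<in> carrier_vec n" for x
      using cg(3)[OF that] that by (simp add: Hom_zero[OF L])
    then have "(\<lambda>x\<in>carrier_vec n.
        (?j (L (?i x)) - ?j (L (?i (0\<^sub>v n)))) + (\<lambda>x\<in>carrier_vec n. 0\<^sub>v m) x) = restrict L (carrier_vec n)"
      by (rule restrict_ext)
    then have "(\<lambda>x\<in>carrier_vec n.
        (?j (L (?i x)) - ?j (L (?i (0\<^sub>v n)))) + (\<lambda>x\<in>carrier_vec n. 0\<^sub>v m) x) = L"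
      by (simp only: extensional_restrict[OF extg(3)])
    ultimately show ?thesis by (simp only: g EA_group_def EA_mult_def monoid.simps prod.case)
  qed
  show "\<exists>h\<in>carrier ?G. h \<otimes>\<^bsub>?G\<^esub> g = \<one>\<^bsub>?G\<^esub>"
  proof -
    obtain A' where A': "A' \<in> AGL TYPE('k) n"
      "\<And>x. x \<in> carrier_vec n \<Longrightarrow> A' (A x) = x" "\<And>x. x \<in> carrier_vec n \<Longrightarrow> A (A' x) = x"
      using inv_AGL[OF A] by metis
    obtain R where R: "R \<in> AGL TYPE('k) m"
      "\<And>x. x \<in> carrier_vec m \<Longrightarrow> R (B x) = x" "\<And>x. x \<in> carrier_vec m \<Longrightarrow> B (R x) = x"
      using inv_AGL[OF B] by metis
    define c where "c = L (A' (0\<^sub>v n))"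
    have c: "c \<in> carrier_vec m" unfolding c_def by (intro cg AGL_closed[OF A'(1)]) simp
    define T where "T = (\<lambda>y\<in>carrier_vec m. y + - c)"
    have T: "T \<in> AGL TYPE('k) m" unfolding T_def using c by (intro translation_AGL) simp
    define B' where "B' = (\<lambda>y\<in>carrier_vec m. R (T y))"
    have B': "B' \<in> AGL TYPE('k) m" unfolding B'_def by (rule compose_AGL[OF R(1) T])
    define M where "M = (\<lambda>x\<in>carrier_vec n. B' (L (A' x)) - B' (L (A' (0\<^sub>v n))))"
    have M: "M \<in> Hom TYPE('k) n m" unfolding M_def by (rule conj_Hom[OF A'(1) B' L])
    define L' where "L' = (\<lambda>x\<in>carrier_vec n. - M x)"
    have L': "L' \<in> Hom TYPE('k) n m" unfolding L'_def by (rule uminus_Hom[OF M])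
    have "B' (B y + c) = y" if y: "y \<in> carrier_vec m" for y
    proof -
      have "B y + c + - c = B y" using cg(2)[OF y] c by (intro eq_vecI) (auto simp: algebra_simps)
      then have "T (B y + c) = B y" using cg(2)[OF y] c by (simp add: T_def)
      then show ?thesis using cg(2)[OF y] c R(2)[OF y] by (simp add: B'_def)
    qed
    moreover have "M x + L' x = 0\<^sub>v m" if x: "x \<in> carrier_vec n" for x
      using Hom_closed[OF M x] x by (simp add: L'_def)
    moreover have "M x + L' x = (B' (L (A' x)) - B' (L (A' (0\<^sub>v n)))) + L' x"
      if "x \<in> carrier_vec n" for x
      using that by (simp add: M_def)
    ultimately have "(\<lambda>x\<in>carrier_vec n. A (A' x)) = (\<lambda>x\<in>carrier_vec n. x)"
      "(\<lambda>y\<in>carrier_vec m. B' (B y + L (A' (0\<^sub>v n)))) = (\<lambda>y\<in>carrier_vec m. y)"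
      "(\<lambda>x\<in>carrier_vec n. (B' (L (A' x)) - B' (L (A' (0\<^sub>v n)))) + L' x) =
        (\<lambda>x\<in>carrier_vec n. 0\<^sub>v m)"
      using A'(3) by (intro restrict_ext; simp add: c_def)+
    then have "(A', B', L') \<otimes>\<^bsub>?G\<^esub> g = \<one>\<^bsub>?G\<^esub>"
      by (simp only: g EA_group_def EA_mult_def monoid.simps prod.case)
    moreover have "(A', B', L') \<in> carrier ?G" using A' B' L' by (simp add: EA_group_def)
    ultimately show ?thesis by blast
  qed
  fix h assume "h \<in> carrier ?G"
  then obtain A1 B1 L1 where h: "h = (A1, B1, L1)" and
    A1: "A1 \<in> AGL TYPE('k) n" and B1: "B1 \<in> AGL TYPE('k) m" and L1: "L1 \<in> Hom TYPE('k) n m"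
    by (auto simp: EA_group_def)
  note ch = AGL_closed[OF A1] AGL_closed[OF B1] Hom_closed[OF L1]
  have z: "0\<^sub>v n \<in> carrier_vec n" by simp
  show "g \<otimes>\<^bsub>?G\<^esub> h \<in> carrier ?G"
  proof -
    let ?c = "L1 (A (0\<^sub>v n))"
    let ?T = "\<lambda>y\<in>carrier_vec m. y + ?c"
    have c: "?c \<in> carrier_vec m" by (intro ch cg z)
    have "(\<lambda>y\<in>carrier_vec m. B (B1 y + ?c)) =
        (\<lambda>y\<in>carrier_vec m. B ((\<lambda>y\<in>carrier_vec m. ?T (B1 y)) y))"
      using ch(2) by (auto simp: fun_eq_iff)
    also have "\<dots> \<in> AGL TYPE('k) m"
      by (intro compose_AGL B B1 translation_AGL c)
    finally have 1: "(\<lambda>y\<in>carrier_vec m. B (B1 y + ?c)) \<in> AGL TYPE('k) m" .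
    have "(\<lambda>x\<in>carrier_vec n. (B (L1 (A x)) - B ?c) + L x) =
        (\<lambda>x\<in>carrier_vec n. (\<lambda>x\<in>carrier_vec n. B (L1 (A x)) - B ?c) x + L x)"
      by (auto simp: fun_eq_iff)
    also have "\<dots> \<in> Hom TYPE('k) n m" by (intro add_Hom conj_Hom A B L1 L)
    finally show ?thesis using 1 compose_AGL[OF A1 A]
      by (simp add: g h EA_group_def EA_mult_def)
  qed
  fix k assume "k \<in> carrier ?G"
  then obtain A2 B2 L2 where k: "k = (A2, B2, L2)" and
    A2: "A2 \<in> AGL TYPE('k) n" and B2: "B2 \<in> AGL TYPE('k) m" and L2: "L2 \<in> Hom TYPE('k) n m"
    by (auto simp: EA_group_def)
  note ck = AGL_closed[OF A2] AGL_closed[OF B2] Hom_closed[OF L2]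
  show "g \<otimes>\<^bsub>?G\<^esub> h \<otimes>\<^bsub>?G\<^esub> k = g \<otimes>\<^bsub>?G\<^esub> (h \<otimes>\<^bsub>?G\<^esub> k)"
  proof -
    let ?a = "A (0\<^sub>v n)"
    define p where "p = L2 (A1 (0\<^sub>v n))"
    define r where "r = L2 (A1 ?a)"
    define s where "s = L1 ?a"
    have car: "p \<in> carrier_vec m" "r \<in> carrier_vec m" "s \<in> carrier_vec m"
      unfolding p_def r_def s_def by (intro ck ch cg z)+
    have Bout: "B (B1 (B2 y + r) + s) = B (B1 (B2 y + p) + (B1 r - B1 p + s))"
      if y: "y \<in> carrier_vec m" for y
    proof -
      have "B2 y + r = (B2 y + p) + r - p"
        using ck(2)[OF y] car by (intro eq_vecI) (auto simp: algebra_simps)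
      then have "B1 (B2 y + r) = B1 (B2 y + p) + B1 r - B1 p"
        using AGL_affine[OF B1, of "B2 y + p" r p] ck(2)[OF y] car by auto
      moreover have "B1 (B2 y + p) + B1 r - B1 p + s = B1 (B2 y + p) + (B1 r - B1 p + s)"
        using ch(2)[of "B2 y + p"] ch(2)[OF car(1)] ch(2)[OF car(2)] ck(2)[OF y] car
        by (intro eq_vecI) (auto simp: algebra_simps)
      ultimately show ?thesis by simp
    qed
    have Lin: "(B (B1 u + s) - B (B1 r + s)) + (B v - B s + L x) =
        (B ((B1 u - B1 p) + v) - B ((B1 r - B1 p) + s)) + L x"
      if u: "u \<in> carrier_vec m" and v: "v \<in> carrier_vec m" and x: "x \<in> carrier_vec n" for u v x
    proof -
      note b = ch(2)[OF u] ch(2)[OF car(1)] ch(2)[OF car(2)]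
      have "B1 u - B1 p + v = (B1 u + s) + v - (B1 p + s)"
        using b v car by (intro eq_vecI) (auto simp: algebra_simps)
      then have 1: "B (B1 u - B1 p + v) = B (B1 u + s) + B v - B (B1 p + s)"
        using AGL_affine[OF B, of "B1 u + s" v "B1 p + s"] b v car by auto
      have "B1 r - B1 p + s = (B1 r + s) + s - (B1 p + s)"
        using b car by (intro eq_vecI) (auto simp: algebra_simps)
      then have 2: "B (B1 r - B1 p + s) = B (B1 r + s) + B s - B (B1 p + s)"
        using AGL_affine[OF B, of "B1 r + s" s "B1 p + s"] b car by auto
      have 3: "B (B1 u + s) \<in> carrier_vec m" "B (B1 r + s) \<in> carrier_vec m"
          "B (B1 p + s) \<in> carrier_vec m" "B v \<in> carrier_vec m" "B s \<in> carrier_vec m"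
        using b v car by (auto intro!: cg(2))
      show ?thesis unfolding 1 2 using 3 cg(3)[OF x] by (intro eq_vecI) (auto simp: algebra_simps)
    qed
    have 1: "(\<lambda>x\<in>carrier_vec n. A2 ((\<lambda>x\<in>carrier_vec n. A1 (A x)) x)) =
        (\<lambda>x\<in>carrier_vec n. (\<lambda>x\<in>carrier_vec n. A2 (A1 x)) (A x))"
      by (rule restrict_ext) (simp add: cg(1))
    have 2: "(\<lambda>y\<in>carrier_vec m.
          (\<lambda>y\<in>carrier_vec m. B (B1 y + s)) (B2 y + L2 ((\<lambda>x\<in>carrier_vec n. A1 (A x)) (0\<^sub>v n)))) =
        (\<lambda>y\<in>carrier_vec m. B ((\<lambda>y\<in>carrier_vec m. B1 (B2 y + p)) y +
          (\<lambda>x\<in>carrier_vec n. (B1 (L2 (A1 x)) - B1 p) + L1 x) ?a))"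
    proof (rule restrict_ext)
      fix y :: "'k vec" assume y: "y \<in> carrier_vec m"
      show "(\<lambda>y\<in>carrier_vec m. B (B1 y + s)) (B2 y + L2 ((\<lambda>x\<in>carrier_vec n. A1 (A x)) (0\<^sub>v n))) =
          B ((\<lambda>y\<in>carrier_vec m. B1 (B2 y + p)) y +
            (\<lambda>x\<in>carrier_vec n. (B1 (L2 (A1 x)) - B1 p) + L1 x) ?a)"
        using Bout[OF y] ck(2)[OF y] y cg(1)[OF z] car by (simp add: r_def[symmetric] s_def[symmetric])
    qed
    have 3: "(\<lambda>x\<in>carrier_vec n.
          ((\<lambda>y\<in>carrier_vec m. B (B1 y + s)) (L2 ((\<lambda>x\<in>carrier_vec n. A1 (A x)) x)) -
           (\<lambda>y\<in>carrier_vec m. B (B1 y + s)) (L2 ((\<lambda>x\<in>carrier_vec n. A1 (A x)) (0\<^sub>v n)))) +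
          (\<lambda>x\<in>carrier_vec n. (B (L1 (A x)) - B s) + L x) x) =
        (\<lambda>x\<in>carrier_vec n.
          (B ((\<lambda>x\<in>carrier_vec n. (B1 (L2 (A1 x)) - B1 p) + L1 x) (A x)) -
           B ((\<lambda>x\<in>carrier_vec n. (B1 (L2 (A1 x)) - B1 p) + L1 x) ?a)) + L x)"
    proof (rule restrict_ext)
      fix x :: "'k vec" assume x: "x \<in> carrier_vec n"
      have u: "L2 (A1 (A x)) \<in> carrier_vec m" and v: "L1 (A x) \<in> carrier_vec m"
        by (intro ck ch cg x)+
      show "((\<lambda>y\<in>carrier_vec m. B (B1 y + s)) (L2 ((\<lambda>x\<in>carrier_vec n. A1 (A x)) x)) -
           (\<lambda>y\<in>carrier_vec m. B (B1 y + s)) (L2 ((\<lambda>x\<in>carrier_vec n. A1 (A x)) (0\<^sub>v n)))) +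
          (\<lambda>x\<in>carrier_vec n. (B (L1 (A x)) - B s) + L x) x =
          (B ((\<lambda>x\<in>carrier_vec n. (B1 (L2 (A1 x)) - B1 p) + L1 x) (A x)) -
           B ((\<lambda>x\<in>carrier_vec n. (B1 (L2 (A1 x)) - B1 p) + L1 x) ?a)) + L x"
        using Lin[OF u v x] u x cg(1)[OF z] cg(1)[OF x] car
        by (simp add: r_def[symmetric] s_def[symmetric])
    qed
    show ?thesis
      using 1 2 3 unfolding p_def s_def
      by (simp only: g h k EA_group_def EA_mult_def monoid.simps prod.case)
  qed
qed

lemma EA_act_closed:
  assumes "g \<in> carrier (EA_group TYPE('k::field) n m)" "F \<in> fun_space TYPE('k) n m"
  shows "EA_act n m g F \<in> fun_space TYPE('k) n m"
proof -
  obtain A B L where g: "g = (A, B, L)" and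
    A: "A \<in> AGL TYPE('k) n" and B: "B \<in> AGL TYPE('k) m" and L: "L \<in> Hom TYPE('k) n m"
    using assms(1) by (auto simp: EA_group_def)
  have "B (F (A x)) + L x \<in> carrier_vec m" if x: "x \<in> carrier_vec n" for x
    by (intro add_carrier_vec AGL_closed[OF B] Hom_closed[OF L] x
        PiE_mem[OF assms(2)[unfolded fun_space_def]] AGL_closed[OF A])
  moreover have "EA_act n m g F = (\<lambda>x\<in>carrier_vec n. B (F (A x)) + L x)"
    using assms(2) by (simp add: EA_act_def g)
  ultimately show ?thesis by (simp add: fun_space_def)
qed

lemma EA_act_mult:
  assumes g: "g \<in> carrier (EA_group TYPE('k::field) n m)"
    and h: "h \<in> carrier (EA_group TYPE('k) n m)" and F: "F \<in> fun_space TYPE('k) n m"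
  shows "EA_act n m (g \<otimes>\<^bsub>EA_group TYPE('k) n m\<^esub> h) F = EA_act n m g (EA_act n m h F)"
proof -
  obtain A B L where g': "g = (A, B, L)" and
    A: "A \<in> AGL TYPE('k) n" and B: "B \<in> AGL TYPE('k) m" and L: "L \<in> Hom TYPE('k) n m"
    using g by (auto simp: EA_group_def)
  obtain A1 B1 L1 where h': "h = (A1, B1, L1)" and
    A1: "A1 \<in> AGL TYPE('k) n" and B1: "B1 \<in> AGL TYPE('k) m" and L1: "L1 \<in> Hom TYPE('k) n m"
    using h by (auto simp: EA_group_def)
  note c = AGL_closed[OF A] AGL_closed[OF B] Hom_closed[OF L]
    AGL_closed[OF A1] AGL_closed[OF B1] Hom_closed[OF L1]
  have Fc: "F x \<in> carrier_vec m" if "x \<in> carrier_vec n" for x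
    using F that by (auto simp: fun_space_def)
  have "B (B1 (F (A1 (A x))) + L1 (A (0\<^sub>v n))) + (B (L1 (A x)) - B (L1 (A (0\<^sub>v n))) + L x) =
      B (B1 (F (A1 (A x))) + L1 (A x)) + L x" if x: "x \<in> carrier_vec n" for x
  proof -
    define u where "u = B1 (F (A1 (A x)))"
    define v where "v = L1 (A x)"
    define s where "s = L1 (A (0\<^sub>v n))"
    have car: "u \<in> carrier_vec m" "v \<in> carrier_vec m" "s \<in> carrier_vec m"
      unfolding u_def v_def s_def using x by (auto intro!: c Fc)
    have "u + v = (u + s) + v - s" using car by (intro eq_vecI) (auto simp: algebra_simps)
    then have "B (u + v) = B (u + s) + B v - B s"
      using AGL_affine[OF B, of "u + s" v s] car by auto
    moreover have "B (u + s) + (B v - B s + L x) = B (u + s) + B v - B s + L x"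
      using c(2)[of "u + s"] c(2)[OF car(2)] c(2)[OF car(3)] c(3)[OF x] car
      by (intro eq_vecI) (auto simp: algebra_simps)
    ultimately show ?thesis unfolding u_def v_def s_def by simp
  qed
  note eq = this
  have hF: "EA_act n m h F \<in> fun_space TYPE('k) n m" using h F by (rule EA_act_closed)
  have hF_eq: "EA_act n m h F = (\<lambda>x\<in>carrier_vec n. B1 (F (A1 x)) + L1 x)"
    using F by (simp add: EA_act_def h')
  have "EA_act n m (g \<otimes>\<^bsub>EA_group TYPE('k) n m\<^esub> h) F =
      (\<lambda>x\<in>carrier_vec n. (\<lambda>y\<in>carrier_vec m. B (B1 y + L1 (A (0\<^sub>v n)))) (F ((\<lambda>x\<in>carrier_vec n. A1 (A x)) x)) +
        (\<lambda>x\<in>carrier_vec n. (B (L1 (A x)) - B (L1 (A (0\<^sub>v n)))) + L x) x)"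
    using F by (simp only: EA_act_def g' h' EA_group_def EA_mult_def monoid.simps prod.case restrict_apply')
  also have "\<dots> = (\<lambda>x\<in>carrier_vec n. B (EA_act n m h F (A x)) + L x)"
    using eq by (intro restrict_ext) (simp add: hF_eq c(1,4) Fc)
  also have "\<dots> = EA_act n m g (EA_act n m h F)"
    using hF by (simp only: EA_act_def g' prod.case restrict_apply')
  finally show ?thesis .
qed

lemma group_action_EA:
  "group_action (EA_group TYPE('k::field) n m) (fun_space TYPE('k) n m) (EA_act n m)"
proof -
  let ?G = "EA_group TYPE('k) n m" and ?E = "fun_space TYPE('k) n m"
  interpret G: group ?G by (rule group_EA_group)
  have one: "EA_act n m \<one>\<^bsub>?G\<^esub> F = F" if "F \<in> ?E" for F
    using that by (auto simp: EA_act_def EA_group_def fun_space_def fun_eq_iff)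
  have act_ext: "EA_act n m g \<in> extensional ?E" for g
    by (auto simp: EA_act_def split: prod.splits)
  have bij: "EA_act n m g \<in> Bij ?E" if g: "g \<in> carrier ?G" for g
  proof -
    have "bij_betw (EA_act n m g) ?E ?E"
      using EA_act_closed[OF g] EA_act_closed[OF G.inv_closed[OF g]]
        EA_act_mult[OF g G.inv_closed[OF g]] EA_act_mult[OF G.inv_closed[OF g] g] one g
      by (intro bij_betw_byWitness[where f' = "EA_act n m (inv\<^bsub>?G\<^esub> g)"]) auto
    then show ?thesis using act_ext by (simp add: Bij_def)
  qed
  have "EA_act n m (g \<otimes>\<^bsub>?G\<^esub> h) = compose ?E (EA_act n m g) (EA_act n m h)"
    if "g \<in> carrier ?G" "h \<in> carrier ?G" for g h
    using EA_act_mult[OF that] act_ext[of "g \<otimes>\<^bsub>?G\<^esub> h"]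
    by (auto simp: compose_def extensional_def fun_eq_iff)
  then have "EA_act n m \<in> hom ?G (BijGroup ?E)"
    using bij by (auto simp: hom_def BijGroup_def)
  then show ?thesis
    by (intro group_action.intro group_hom.intro group_hom_axioms.intro
        group_EA_group group_BijGroup)
qed

end

theory Submission
  imports Defs "HOL-Real_Asymp.Real_Asymp"
begin

text \<open>
  For fixed \<open>F\<close>, every group element sends \<open>F\<close> to at most one \<open>G\<close> (for CCZ because a function is
  determined by its graph), so at most \<open>|group|\<close> of the \<open>|\<F>|\<close> functions are equivalent to \<open>F\<close>.
  A linear map is determined by its values on the standard basis, so both group orders lie between
  \<open>1\<close> and \<open>q ^ (2 * (n + m)\<^sup>2)\<close>; the exponent \<open>m * q ^ n\<close> of \<open>|\<F>|\<close> dominates this.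
\<close>

lemma card_carrier_vec: "card (carrier_vec n :: 'k::finite vec set) = CARD('k) ^ n"
proof -
  have "bij_betw list_of_vec (carrier_vec n :: 'k vec set) {xs. set xs \<subseteq> UNIV \<and> length xs = n}"
    by (rule bij_betw_byWitness[where f' = vec_of_list]) (auto simp: vec_list list_vec intro!: carrier_vecI)
  then show ?thesis
    using card_lists_length_eq[of "UNIV :: 'k set" n] by (simp add: bij_betw_same_card)
qed

lemma card_fun_space: "card (fun_space TYPE('k::finite) n m) = CARD('k) ^ (m * CARD('k) ^ n)"
  by (simp add: fun_space_def card_funcsetE finite_carrier_vec card_carrier_vec power_mult)

text \<open>A linear map is determined by its values on the standard basis. Instead of expanding a
  vector as a sum over the basis, the proof removes one coordinate at a time.\<close>

lemma Hom_eqI: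
  assumes L: "L \<in> Hom TYPE('k::field) n m" and L': "L' \<in> Hom TYPE('k) n m"
    and eq: "\<And>i. i < n \<Longrightarrow> L (unit_vec n i) = L' (unit_vec n i)"
  shows "L = L'"
proof (rule extensionalityI[OF Hom_ext[OF L] Hom_ext[OF L']])
  \<comment> \<open>Induction on a bound \<open>k\<close> beyond which all coordinates of
    \<open>v\<close> vanish; \<open>k = n\<close> puts no restriction on \<open>v\<close>.\<close>
  have *: "L v = L' v" if "v \<in> carrier_vec n" "k \<le> n" "\<And>i. k \<le> i \<Longrightarrow> i < n \<Longrightarrow> v $ i = 0" for v k
    using that
  proof (induction k arbitrary: v)
    case 0
    then have "v = 0\<^sub>v n" by (intro eq_vecI) auto
    then show ?case by (simp add: Hom_zero[OF L] Hom_zero[OF L'])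
  next
    case (Suc k)
    \<comment> \<open>\<open>w\<close> is \<open>v\<close> with its last possibly nonzero coordinate
      cleared, so the induction hypothesis covers \<open>w\<close> and \<open>v - w\<close> is a
      multiple of a basis vector.\<close>
    define w where "w = vec n (\<lambda>i. if i = k then 0 else v $ i)"
    have w: "w \<in> carrier_vec n" by (simp add: w_def)
    have "w $ i = 0" if "k \<le> i" "i < n" for i
      using Suc.prems(3)[of i] that by (cases "i = k") (auto simp: w_def)
    with Suc.IH[OF w] Suc.prems(2) have "L w = L' w" by simp
    moreover have "v = w + v $ k \<cdot>\<^sub>v unit_vec n k"
      using Suc.prems(1,2) by (intro eq_vecI) (auto simp: w_def)
    ultimately show ?case
      using w Suc.prems(2) eq[of k]
      by (metis Hom_add[OF L] Hom_add[OF L'] Hom_smult[OF L] Hom_smult[OF L'] Suc_le_lessD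
          smult_carrier_vec unit_vec_carrier)
  qed
  fix v :: "'k vec" assume "v \<in> carrier_vec n"
  then show "L v = L' v" by (rule *[of v n]) auto
qed

lemma finite_Hom: "finite (Hom TYPE('k::{field,finite}) n m)"
  by (rule finite_subset[OF _ finite_fun_space[of n m]]) (auto simp: Hom_iff fun_space_def)

text \<open>Evaluation on the standard basis embeds the linear maps into the \<open>n\<close>-tuples
  of vectors of length \<open>m\<close>.\<close>

lemma card_Hom_le: "card (Hom TYPE('k::{field,finite}) n m) \<le> CARD('k) ^ (n * m)"
proof -
  let ?T = "{..<n} \<rightarrow>\<^sub>E (carrier_vec m :: 'k vec set)"
  let ?f = "\<lambda>L :: 'k vec \<Rightarrow> 'k vec. \<lambda>i\<in>{..<n}. L (unit_vec n i)"
  have "inj_on ?f (Hom TYPE('k) n m)"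
  proof (rule inj_onI)
    fix L L' :: "'k vec \<Rightarrow> 'k vec"
    assume LL: "L \<in> Hom TYPE('k) n m" "L' \<in> Hom TYPE('k) n m" and eq: "?f L = ?f L'"
    show "L = L'"
    proof (rule Hom_eqI[OF LL])
      fix i assume "i < n"
      then show "L (unit_vec n i) = L' (unit_vec n i)" using fun_cong[OF eq, of i] by simp
    qed
  qed
  moreover have "?f ` Hom TYPE('k) n m \<subseteq> ?T"
  proof (rule image_subsetI)
    fix L assume L: "L \<in> Hom TYPE('k) n m"
    show "?f L \<in> ?T" using Hom_closed[OF L] by (simp add: restrict_PiE_iff)
  qed
  moreover have "finite ?T" by (intro finite_PiE finite_carrier_vec) simp
  ultimately have "card (Hom TYPE('k) n m) \<le> card ?T" by (rule card_inj_on_le)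
  also have "card ?T = CARD('k) ^ (n * m)"
    by (simp add: card_funcsetE card_carrier_vec mult.commute flip: power_mult)
  finally show ?thesis .
qed

text \<open>Every affine permutation comes from a pair \<open>(P, a)\<close>. Counting all linear
  \<open>P\<close>, invertible or not, gives the upper bound.\<close>

lemma
  shows finite_AGL: "finite (AGL TYPE('k::{field,finite}) n)"
    and card_AGL_le: "card (AGL TYPE('k) n) \<le> CARD('k) ^ (n * n + n)"
proof -
  let ?S = "Hom TYPE('k) n n \<times> (carrier_vec n :: 'k vec set)"
  have sub: "AGL TYPE('k) n \<subseteq> (\<lambda>(P, a). \<lambda>x\<in>carrier_vec n. P x + a) ` ?S"
    by (auto simp: AGL_def)
  have fin: "finite ?S" by (intro finite_cartesian_product finite_Hom finite_carrier_vec)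
  show "finite (AGL TYPE('k) n)" using finite_surj[OF fin sub] .
  have "card (AGL TYPE('k) n) \<le> card ?S" using surj_card_le[OF fin sub] .
  also have "\<dots> \<le> CARD('k) ^ (n * n) * CARD('k) ^ n"
    unfolding card_cartesian_product card_carrier_vec by (intro mult_right_mono card_Hom_le) simp
  finally show "card (AGL TYPE('k) n) \<le> CARD('k) ^ (n * n + n)" by (simp add: power_add)
qed

text \<open>The order of the group must be at least 1 for its logarithm to be nonnegative in
  \<open>ratio_asymptotics\<close>.\<close>

lemma card_AGL_pos: "0 < card (AGL TYPE('k::{field,finite}) n)"
  using one_AGL finite_AGL by (metis card_gt_0_iff empty_iff)

lemma finite_EA_group: "finite (carrier (EA_group TYPE('k::{field,finite}) n m))"
  by (simp add: EA_group_def finite_AGL finite_Hom)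

lemma card_EA_group_pos: "0 < card (carrier (EA_group TYPE('k::{field,finite}) n m))"
  using finite_EA_group group.is_monoid[OF group_EA_group] monoid.one_closed
  by (metis card_gt_0_iff empty_iff)

lemma card_EA_group_le:
  "card (carrier (EA_group TYPE('k::{field,finite}) n m)) \<le> CARD('k) ^ (2 * (n + m)\<^sup>2)"
proof -
  have "card (carrier (EA_group TYPE('k) n m)) =
      card (AGL TYPE('k) n) * (card (AGL TYPE('k) m) * card (Hom TYPE('k) n m))"
    by (simp add: EA_group_def card_cartesian_product)
  also have "\<dots> \<le> CARD('k) ^ (n * n + n) * (CARD('k) ^ (m * m + m) * CARD('k) ^ (n * m))"
    by (intro mult_mono card_AGL_le card_Hom_le) auto
  also have "\<dots> = CARD('k) ^ ((n * n + n) + ((m * m + m) + n * m))" by (simp only: power_add)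
  also have "\<dots> \<le> CARD('k) ^ (2 * (n + m)\<^sup>2)"
  proof (rule power_increasing)
    \<comment> \<open>The linear terms are absorbed by the squares; this is where the factor 2 in
      the exponent comes from.\<close>
    have "n \<le> n * n" "m \<le> m * m" by (cases n; simp) (cases m; simp)
    moreover have "2 * (n + m)\<^sup>2 = 2 * (n * n) + 2 * (m * m) + 4 * (n * m)"
      by (simp add: power2_eq_square algebra_simps)
    ultimately show "(n * n + n) + ((m * m + m) + n * m) \<le> 2 * (n + m)\<^sup>2" by linarith
  qed (simp add: Suc_leI)
  finally show ?thesis .
qed

text \<open>Used in dimension \<open>n + m\<close>, this gives the same bound as for the EA
  group.\<close>

lemma card_AGL_le_square: "card (AGL TYPE('k::{field,finite}) n) \<le> CARD('k) ^ (2 * n\<^sup>2)"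
proof -
  have "n * n + n \<le> 2 * n\<^sup>2" by (cases n) (auto simp: power2_eq_square)
  then have "CARD('k) ^ (n * n + n) \<le> CARD('k) ^ (2 * n\<^sup>2)"
    by (intro power_increasing) (simp_all add: Suc_leI)
  with card_AGL_le[of n, where 'k = 'k] show ?thesis by linarith
qed

lemma card_EA_equiv_le:
  "card {G \<in> fun_space TYPE('k::{field,finite}) n m. EA_equiv n m F G}
     \<le> card (carrier (EA_group TYPE('k) n m))"
  by (rule surj_card_le[OF finite_EA_group, where f = "\<lambda>g. EA_act n m g F"])
     (auto simp: EA_equiv_def orbit_def)

text \<open>The first block of a concatenated vector has the fixed length \<open>n\<close>, so a
  point of the graph determines both the argument and the value.\<close>

lemma inj_on_Gr: "inj_on (Gr n) (fun_space TYPE('k) n m)"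
proof (rule inj_onI)
  fix F G :: "'k vec \<Rightarrow> 'k vec"
  assume F: "F \<in> fun_space TYPE('k) n m" and G: "G \<in> fun_space TYPE('k) n m" and eq: "Gr n F = Gr n G"
  show "F = G"
  proof (rule PiE_ext[OF F[unfolded fun_space_def] G[unfolded fun_space_def]])
    fix x :: "'k vec" assume x: "x \<in> carrier_vec n"
    then have "x @\<^sub>v F x \<in> Gr n G" using eq by (auto simp: Gr_def)
    then obtain y where y: "y \<in> carrier_vec n" "x @\<^sub>v F x = y @\<^sub>v G y" by (auto simp: Gr_def)
    then show "F x = G x" using append_vec_eq[OF x y(1)] by auto
  qed
qed

text \<open>Affine permutations act on graphs and may send \<open>Gr n F\<close> to a set that is no
  graph. Hence graphs are counted in place of functions: those of the functions equivalent to
  \<open>F\<close> lie among the images of \<open>Gr n F\<close>.\<close>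

lemma card_CCZ_equiv_le:
  "card {G \<in> fun_space TYPE('k::{field,finite}) n m. CCZ_equiv n m F G} \<le> card (AGL TYPE('k) (n + m))"
proof -
  let ?S = "{G \<in> fun_space TYPE('k) n m. CCZ_equiv n m F G}"
  have "inj_on (Gr n) ?S" using inj_on_Gr by (rule inj_on_subset) auto
  then have "card ?S = card (Gr n ` ?S)" by (simp add: card_image)
  also have "\<dots> \<le> card (AGL TYPE('k) (n + m))"
    by (rule surj_card_le[OF finite_AGL, where f = "\<lambda>\<Phi>. \<Phi> ` Gr n F"]) (auto simp: CCZ_equiv_def)
  finally show ?thesis .
qed

lemma pair_pmf_of_set:
  assumes "finite A" "A \<noteq> {}" "finite B" "B \<noteq> {}"
  shows "pair_pmf (pmf_of_set A) (pmf_of_set B) = pmf_of_set (A \<times> B)"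
proof (rule pmf_eqI)
  fix z :: "'a \<times> 'b"
  show "pmf (pair_pmf (pmf_of_set A) (pmf_of_set B)) z = pmf (pmf_of_set (A \<times> B)) z"
    using assms by (cases z) (auto simp: pmf_pair card_cartesian_product indicator_def)
qed

text \<open>Summing the fibres over the first component gives at most \<open>card X * k\<close>
  related pairs among the \<open>card X * card X\<close> equally likely ones.\<close>

lemma prob_pair_related_le:
  assumes X: "finite X" "X \<noteq> {}" and le: "\<And>x. x \<in> X \<Longrightarrow> card {y \<in> X. R x y} \<le> k"
  shows "measure_pmf.prob (pair_pmf (pmf_of_set X) (pmf_of_set X)) {(x, y). R x y} \<le> k / card X"
proof -
  have "card ((X \<times> X) \<inter> {(x, y). R x y}) = card (SIGMA x:X. {y \<in> X. R x y})"
    by (rule arg_cong[of _ _ card]) auto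
  also have "\<dots> = (\<Sum>x\<in>X. card {y \<in> X. R x y})" using X by (intro card_SigmaI) auto
  also have "\<dots> \<le> card X * k" using sum_bounded_above[OF le, of X "\<lambda>x. x"] by simp
  finally have "real (card ((X \<times> X) \<inter> {(x, y). R x y})) \<le> card X * real k"
    by (metis of_nat_le_iff of_nat_mult)
  then have "card ((X \<times> X) \<inter> {(x, y). R x y}) / (real (card X) * card X)
      \<le> card X * real k / (real (card X) * card X)"
    by (rule divide_right_mono) simp
  then show ?thesis
    using X by (simp add: pair_pmf_of_set measure_pmf_of_set card_cartesian_product)
qed

text \<open>With \<open>e n\<close> the base-\<open>q\<close> logarithm of \<open>N n\<close>, both
  formulas are exact for every \<open>n\<close>, with \<open>h n = m * q ^ n - e n\<close>. Only the
  growth of \<open>e\<close> and \<open>h\<close> needs estimates. Both groups are instances with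
  \<open>c = 2\<close>.\<close>

lemma ratio_asymptotics:
  fixes N :: "nat \<Rightarrow> nat" and q m c :: nat
  assumes q: "2 \<le> q" and m: "1 \<le> m"
    and pos: "\<And>n. 0 < N n" and le: "\<And>n. N n \<le> q ^ (c * (n + m)\<^sup>2)"
  shows "(\<exists>e \<in> O(\<lambda>n. real ((n + m)\<^sup>2)). \<forall>n\<ge>1.
        real (N n) / real (q ^ (m * q ^ n)) = real q powr (- real (m * q ^ n) + e n))
     \<and> (\<exists>h \<in> at_least_order (\<lambda>n. real (q ^ n)). \<forall>n\<ge>1.
        real (N n) / real (q ^ (m * q ^ n)) = real q powr (- h n))"
proof -
  define e where "e n = log (real q) (real (N n))" for n
  have e0: "0 \<le> e n" and ec: "e n \<le> real (c * (n + m)\<^sup>2)" for n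
  proof -
    show "0 \<le> e n" using q pos[of n] by (simp add: e_def Suc_leI)
    have "e n \<le> log (real q) (real (q ^ (c * (n + m)\<^sup>2)))"
      unfolding e_def using q pos[of n] le[of n] by (subst log_le_cancel_iff) (auto simp flip: of_nat_power)
    also have "\<dots> = real (c * (n + m)\<^sup>2)" using q by (simp add: log_nat_power)
    finally show "e n \<le> real (c * (n + m)\<^sup>2)" .
  qed
  have eq: "real (N n) / real (q ^ (m * q ^ n)) = real q powr (- real (m * q ^ n) + e n)" for n
  proof -
    have "real q powr e n = N n" using q pos[of n] by (simp add: e_def)
    moreover have "real q powr (- real (m * q ^ n)) = inverse (real (q ^ (m * q ^ n)))"
      using q by (simp add: powr_minus powr_realpow flip: of_nat_power of_nat_mult)
    ultimately show ?thesis by (simp only: powr_add divide_inverse mult.commute)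
  qed
  have "e \<in> O(\<lambda>n. real ((n + m)\<^sup>2))"
    by (rule bigoI[where c = "real c"]) (use e0 ec in auto)
  moreover have "(\<lambda>n. real (m * q ^ n) - e n) \<in> at_least_order (\<lambda>n. real (q ^ n))"
  proof -
    \<comment> \<open>Since \<open>q \<ge> 2\<close>, half of \<open>q ^ n\<close> eventually
      exceeds the quadratic bound on \<open>e n\<close>; the other half remains as the lower bound
      on \<open>h n\<close>, with constant \<open>1/2\<close>.\<close>
    have "\<forall>\<^sub>F n in sequentially. real c * (real n + real m)\<^sup>2 \<le> (1/2) * 2 ^ n"
      by real_asymp
    then have "\<forall>\<^sub>F n in sequentially. (1/2) * real (q ^ n) \<le> real (m * q ^ n) - e n"
    proof eventually_elim
      case (elim n)
      have "(2::real) ^ n \<le> real (q ^ n)" using q by (simp add: power_mono)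
      moreover have "real (q ^ n) \<le> real (m * q ^ n)" using m by (simp flip: of_nat_power of_nat_mult)
      moreover have "e n \<le> real c * (real n + real m)\<^sup>2" using ec[of n] by simp
      ultimately show ?case using elim by linarith
    qed
    then show ?thesis by (auto simp: at_least_order_def intro!: exI[of _ "1/2"])
  qed
  ultimately show ?thesis
    using eq
    by (intro conjI bexI[of _ e] bexI[of _ "\<lambda>n. real (m * q ^ n) - e n"]) simp_all
qed

theorem proposition3p8:
  fixes q m :: nat
  assumes "CARD('k::{field,finite}) = q"
    and "m \<ge> 1"
  shows
    "((\<forall>n\<ge>1. measure_pmf.prob (random_pair TYPE('k) n m) {(F, G). EA_equiv n m F G}
        \<le> real (card (carrier (EA_group TYPE('k) n m))) / real (card (fun_space TYPE('k) n m)))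
     \<and> (\<exists>e \<in> O(\<lambda>n. real ((n + m)\<^sup>2)). \<forall>n\<ge>1.
        real (card (carrier (EA_group TYPE('k) n m))) / real (card (fun_space TYPE('k) n m))
          = real q powr (- real (m * q ^ n) + e n))
     \<and> (\<exists>h \<in> at_least_order (\<lambda>n. real (q ^ n)). \<forall>n\<ge>1.
        real (card (carrier (EA_group TYPE('k) n m))) / real (card (fun_space TYPE('k) n m))
          = real q powr (- h n)))
     \<and>
     ((\<forall>n\<ge>1. measure_pmf.prob (random_pair TYPE('k) n m) {(F, G). CCZ_equiv n m F G}
        \<le> real (card (AGL TYPE('k) (n + m))) / real (card (fun_space TYPE('k) n m)))
     \<and> (\<exists>e \<in> O(\<lambda>n. real ((n + m)\<^sup>2)). \<forall>n\<ge>1.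
        real (card (AGL TYPE('k) (n + m))) / real (card (fun_space TYPE('k) n m))
          = real q powr (- real (m * q ^ n) + e n))
     \<and> (\<exists>h \<in> at_least_order (\<lambda>n. real (q ^ n)). \<forall>n\<ge>1.
        real (card (AGL TYPE('k) (n + m))) / real (card (fun_space TYPE('k) n m))
          = real q powr (- h n)))"
proof -
  \<comment> \<open>A field has \<open>0 \<noteq> 1\<close>, hence at least two elements.\<close>
  have "card {0, 1 :: 'k} \<le> CARD('k)" by (intro card_mono) auto
  then have q: "2 \<le> q" using assms(1) by simp
  have F: "card (fun_space TYPE('k) n m) = q ^ (m * q ^ n)" for n
    using card_fun_space[of n m, where 'k = 'k] assms(1) by simp
  have "measure_pmf.prob (random_pair TYPE('k) n m) {(F, G). EA_equiv n m F G}
        \<le> real (card (carrier (EA_group TYPE('k) n m))) / real (card (fun_space TYPE('k) n m))" for n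
    unfolding random_pair_def
    by (rule prob_pair_related_le[OF finite_fun_space fun_space_nonempty card_EA_equiv_le])
  moreover have "measure_pmf.prob (random_pair TYPE('k) n m) {(F, G). CCZ_equiv n m F G}
        \<le> real (card (AGL TYPE('k) (n + m))) / real (card (fun_space TYPE('k) n m))" for n
    unfolding random_pair_def
    by (rule prob_pair_related_le[OF finite_fun_space fun_space_nonempty card_CCZ_equiv_le])
  moreover note
    ratio_asymptotics[OF q assms(2) card_EA_group_pos card_EA_group_le[where 'k = 'k, unfolded assms(1)]]
    ratio_asymptotics[OF q assms(2) card_AGL_pos
      card_AGL_le_square[where 'k = 'k and n = "_ + m", unfolded assms(1)]]
  ultimately show ?thesis unfolding F by blast
qed

end
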